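(* Let $U\subset\mathbb{R}^d$ be bounded and open, $T>0$, $\Omega=U\times(0,T]$, and let $\Gamma(\Omega)=(\overline U\times\{0\})\cup(\partial U\times(0,T])$ be its parabolic boundary. Let $P$ be a polynomial, let $u,v\in\mathcal{C}^{2,1}(\Omega)$, and let $a_0>0$ be a constant such that $P(u(x,t))\ge a_0$ for all $(x,t)\in\Omega$. If $$Lv:=\frac{\partial v}{\partial t}-P(u)\Delta v>0\quad\text{in }\Omega,$$ then $v(x,t)\ge\min_{\Gamma(\Omega)}v$ for all $(x,t)\in\Omega$.
   Context: $\mathcal{C}^{2,1}(\Omega)$ is the class of functions continuous on $\overline\Omega$ that have two continuous derivatives in $x$ and one continuous derivative in $t$ in $\Omega$ (at $t=T$ the time derivative is the one-sided derivative from below). $\Delta$ is the Laplacian in $x\in\mathbb{R}^d$. *)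

theory Defs
  imports "HOL-Analysis.Analysis" "HOL-Computational_Algebra.Polynomial"
begin

definition parabolic_domain :: "(real ^ 'd) set \<Rightarrow> real \<Rightarrow> ((real ^ 'd) \<times> real) set" where
  "parabolic_domain U T = U \<times> {0<..T}"

definition parabolic_boundary :: "(real ^ 'd) set \<Rightarrow> real \<Rightarrow> ((real ^ 'd) \<times> real) set" where
  "parabolic_boundary U T = (closure U \<times> {0}) \<union> (frontier U \<times> {0<..T})"

definition has_dx :: "'d \<Rightarrow> ((real ^ 'd) \<times> real \<Rightarrow> real) \<Rightarrow> (real ^ 'd) \<times> real \<Rightarrow> bool" where
  "has_dx i f z \<longleftrightarrow> (\<lambda>s. f (fst z + s *\<^sub>R axis i 1, snd z)) field_differentiable (at 0)"

definition dx :: "'d \<Rightarrow> ((real ^ 'd) \<times> real \<Rightarrow> real) \<Rightarrow> (real ^ 'd) \<times> real \<Rightarrow> real" where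
  "dx i f z = deriv (\<lambda>s. f (fst z + s *\<^sub>R axis i 1, snd z)) 0"

text \<open>The time derivative is taken within \<open>(0, T]\<close>: this is the ordinary derivative for
  \<open>0 < t < T\<close> and the one-sided derivative from below at \<open>t = T\<close>.\<close>

definition has_dt :: "real \<Rightarrow> ((real ^ 'd) \<times> real \<Rightarrow> real) \<Rightarrow> (real ^ 'd) \<times> real \<Rightarrow> bool" where
  "has_dt T f z \<longleftrightarrow> (\<lambda>s. f (fst z, s)) differentiable (at (snd z) within {0<..T})"

definition dt :: "real \<Rightarrow> ((real ^ 'd) \<times> real \<Rightarrow> real) \<Rightarrow> (real ^ 'd) \<times> real \<Rightarrow> real" where
  "dt T f z = vector_derivative (\<lambda>s. f (fst z, s)) (at (snd z) within {0<..T})"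

definition laplacian_x :: "((real ^ 'd) \<times> real \<Rightarrow> real) \<Rightarrow> (real ^ 'd) \<times> real \<Rightarrow> real" where
  "laplacian_x f z = (\<Sum>i\<in>UNIV. dx i (dx i f) z)"

definition C21 :: "(real ^ 'd) set \<Rightarrow> real \<Rightarrow> ((real ^ 'd) \<times> real \<Rightarrow> real) set" where
  "C21 U T = {f.
     continuous_on (closure (parabolic_domain U T)) f \<and>
     (\<forall>i. (\<forall>z\<in>parabolic_domain U T. has_dx i f z) \<and>
          continuous_on (parabolic_domain U T) (dx i f)) \<and>
     (\<forall>i j. (\<forall>z\<in>parabolic_domain U T. has_dx i (dx j f) z) \<and>
            continuous_on (parabolic_domain U T) (dx i (dx j f))) \<and>
     (\<forall>z\<in>parabolic_domain U T. has_dt T f z) \<and>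
     continuous_on (parabolic_domain U T) (dt T f)}"

end

theory Submission
  imports Defs
begin

text \<open>
  By compactness \<open>v\<close> attains its minimum over \<open>closure U \<times> {0..T}\<close>. At a minimum point
  in \<open>U \<times> {0<..T}\<close> one would have \<open>\<partial>v/\<partial>t \<le> 0\<close> (compare with earlier times) and \<open>\<Delta>v \<ge> 0\<close>,
  contradicting \<open>Lv > 0\<close> as \<open>P(u) > 0\<close>; so the minimum point lies on the parabolic boundary.
\<close>

lemma second_derivative_nonneg_at_local_min:
  fixes g g' :: "real \<Rightarrow> real"
  assumes deriv: "\<forall>\<^sub>F s in nhds a. (g has_real_derivative g' s) (at s)"
    and deriv2: "(g' has_real_derivative D) (at a)"
    and local_min: "\<forall>\<^sub>F s in nhds a. g a \<le> g s"
  shows "D \<ge> 0"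
proof (rule ccontr)
  assume "\<not> D \<ge> 0"
  then have "D < 0" by simp
  from eventually_conj[OF deriv local_min] obtain d where d: "d > 0"
    and deriv_near: "\<And>s. \<bar>s - a\<bar> < d \<Longrightarrow> (g has_real_derivative g' s) (at s)"
    and min_near: "\<And>s. \<bar>s - a\<bar> < d \<Longrightarrow> g a \<le> g s"
    by (auto simp: eventually_nhds_metric dist_real_def)
  have "g' a = 0"
    using DERIV_local_min[OF deriv_near[of a] d] min_near d by (simp add: abs_minus_commute)
  with DERIV_neg_dec_right[OF deriv2 \<open>D < 0\<close>] obtain e
    where e: "e > 0" and g'_neg: "\<And>h. 0 < h \<Longrightarrow> h < e \<Longrightarrow> g' (a + h) < 0" by auto
  define h where "h = min d e / 2"
  have h: "0 < h" "h < d" "h < e" using d e by (auto simp: h_def)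
  obtain \<xi> where \<xi>: "a < \<xi>" "\<xi> < a + h" and mvt: "g (a + h) - g a = h * g' \<xi>"
    using MVT2[of a "a + h" g g'] deriv_near h by auto
  have "g' \<xi> < 0" using g'_neg[of "\<xi> - a"] \<xi> h by simp
  then have "h * g' \<xi> < 0" using h(1) by (simp add: mult_pos_neg)
  with mvt min_near[of "a + h"] h show False by simp
qed

lemma left_derivative_nonpos_at_local_min:
  fixes g :: "real \<Rightarrow> real"
  assumes deriv: "(g has_real_derivative D) (at_left a)"
    and local_min: "\<forall>\<^sub>F s in at_left a. g a \<le> g s"
  shows "D \<le> 0"
proof (rule tendsto_upperbound)
  show "((\<lambda>s. (g s - g a) / (s - a)) \<longlongrightarrow> D) (at_left a)"
    using deriv by (simp add: has_field_derivative_iff)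
  have "\<forall>\<^sub>F s in at_left a. s < a" by (simp add: eventually_at_filter)
  with local_min show "\<forall>\<^sub>F s in at_left a. (g s - g a) / (s - a) \<le> 0"
    by eventually_elim (simp add: divide_nonneg_neg)
qed simp

lemma has_real_derivative_dx:
  fixes x :: "real ^ 'd"
  assumes "has_dx i f (x + s *\<^sub>R axis i 1, t)"
  shows "((\<lambda>r. f (x + r *\<^sub>R axis i 1, t)) has_real_derivative
    dx i f (x + s *\<^sub>R axis i 1, t)) (at s)"
proof -
  have "((\<lambda>r. f (x + s *\<^sub>R axis i 1 + r *\<^sub>R axis i 1, t)) has_real_derivative
      dx i f (x + s *\<^sub>R axis i 1, t)) (at 0)"
    using assms by (simp add: has_dx_def dx_def DERIV_deriv_iff_field_differentiable)
  then have "((\<lambda>r. f (x + (r + s) *\<^sub>R axis i 1, t)) has_real_derivative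
      dx i f (x + s *\<^sub>R axis i 1, t)) (at 0)"
    by (simp add: algebra_simps)
  then show ?thesis
    using DERIV_shift[of "\<lambda>r. f (x + r *\<^sub>R axis i 1, t)" _ 0 s] by simp
qed

lemma dx_dx_nonneg_at_local_min:
  fixes x :: "real ^ 'd"
  assumes "\<forall>\<^sub>F y in nhds x. has_dx i f (y, t)" and "has_dx i (dx i f) (x, t)"
    and "\<forall>\<^sub>F y in nhds x. f (x, t) \<le> f (y, t)"
  shows "dx i (dx i f) (x, t) \<ge> 0"
proof -
  let ?line = "\<lambda>s. x + s *\<^sub>R axis i 1"
  have line: "filterlim ?line (nhds x) (nhds 0)"
    by (auto intro!: tendsto_eq_intros filterlim_ident)
  have "\<forall>\<^sub>F s in nhds 0. ((\<lambda>r. f (?line r, t)) has_real_derivative dx i f (?line s, t)) (at s)"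
    using eventually_compose_filterlim[OF assms(1) line]
    by (rule eventually_mono) (rule has_real_derivative_dx)
  moreover have "((\<lambda>s. dx i f (?line s, t)) has_real_derivative dx i (dx i f) (x, t)) (at 0)"
    using has_real_derivative_dx[of i "dx i f" x 0 t] assms(2) by simp
  moreover have "\<forall>\<^sub>F s in nhds 0. f (?line 0, t) \<le> f (?line s, t)"
    using eventually_compose_filterlim[OF assms(3) line] by simp
  ultimately show ?thesis by (rule second_derivative_nonneg_at_local_min)
qed

lemma laplacian_x_nonneg_at_local_min:
  fixes x :: "real ^ 'd"
  assumes "\<And>i. \<forall>\<^sub>F y in nhds x. has_dx i f (y, t)" and "\<And>i. has_dx i (dx i f) (x, t)"
    and "\<forall>\<^sub>F y in nhds x. f (x, t) \<le> f (y, t)"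
  shows "laplacian_x f (x, t) \<ge> 0"
  unfolding laplacian_x_def by (intro sum_nonneg dx_dx_nonneg_at_local_min assms)

lemma dt_nonpos_at_local_min:
  fixes x :: "real ^ 'd"
  assumes t: "t \<in> {0<..T}" and diff: "has_dt T f (x, t)"
    and local_min: "\<forall>\<^sub>F s in at_left t. f (x, t) \<le> f (x, s)"
  shows "dt T f (x, t) \<le> 0"
proof (rule left_derivative_nonpos_at_local_min)
  have "((\<lambda>s. f (x, s)) has_real_derivative dt T f (x, t)) (at t within {0<..T})"
    using diff by (simp add: has_dt_def dt_def vector_derivative_works
        has_real_derivative_iff_has_vector_derivative)
  then have "((\<lambda>s. f (x, s)) has_real_derivative dt T f (x, t)) (at t within {0<..<t})"
    by (rule has_field_derivative_subset) (use t in auto)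
  moreover have "at t within {0<..<t} = at_left t"
    using t by (intro at_within_nhd[of t "{0<..}"]) auto
  ultimately show "((\<lambda>s. f (x, s)) has_real_derivative dt T f (x, t)) (at_left t)" by simp
qed (rule local_min)

lemma closure_parabolic_domain:
  assumes "T > 0"
  shows "closure (parabolic_domain U T) = closure U \<times> {0..T}"
  using assms by (simp add: parabolic_domain_def closure_Times)

lemma closure_parabolic_domain_eq_Un:
  assumes "open U" "T > 0"
  shows "closure (parabolic_domain U T) = parabolic_domain U T \<union> parabolic_boundary U T"
  unfolding closure_parabolic_domain[OF \<open>T > 0\<close>]
  using assms closure_subset[of U]
  by (auto simp: parabolic_domain_def parabolic_boundary_def frontier_def interior_open)

lemma compact_closure_parabolic_domain:
  assumes "bounded U"
  shows "compact (closure (parabolic_domain U T))"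
  using assms by (simp add: parabolic_domain_def bounded_Times bounded_Ioc)

definition parabolic_op ::
  "real \<Rightarrow> ((real ^ 'd) \<times> real \<Rightarrow> real) \<Rightarrow> ((real ^ 'd) \<times> real \<Rightarrow> real) \<Rightarrow> (real ^ 'd) \<times> real \<Rightarrow> real"
  where "parabolic_op T a f z = dt T f z - a z * laplacian_x f z"

lemma parabolic_op_nonpos_at_min:
  assumes "open U" and f: "f \<in> C21 U T" and p: "p \<in> parabolic_domain U T" and "a p \<ge> 0"
    and min: "\<And>q. q \<in> parabolic_domain U T \<Longrightarrow> f p \<le> f q"
  shows "parabolic_op T a f p \<le> 0"
proof -
  obtain x t where xt: "p = (x, t)" and x: "x \<in> U" and t: "t \<in> {0<..T}"
    using p by (auto simp: parabolic_domain_def)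
  have near_x: "\<forall>\<^sub>F y in nhds x. (y, t) \<in> parabolic_domain U T"
    using eventually_nhds_in_open[OF \<open>open U\<close> x] t by (simp add: parabolic_domain_def)
  have "laplacian_x f p \<ge> 0"
    unfolding xt
  proof (rule laplacian_x_nonneg_at_local_min)
    show "\<forall>\<^sub>F y in nhds x. has_dx i f (y, t)" for i
      using near_x f by (auto simp: C21_def elim: eventually_mono)
    show "has_dx i (dx i f) (x, t)" for i
      using f p by (simp add: C21_def xt)
    show "\<forall>\<^sub>F y in nhds x. f (x, t) \<le> f (y, t)"
      using near_x min by (auto simp: xt elim: eventually_mono)
  qed
  moreover have "dt T f p \<le> 0"
    unfolding xt
  proof (rule dt_nonpos_at_local_min[OF t])
    show "has_dt T f (x, t)" using f p by (simp add: C21_def xt)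
    have "\<forall>\<^sub>F s in at_left t. (x, s) \<in> parabolic_domain U T"
      using eventually_at_left_real[of 0 t] x t
      by (auto simp: parabolic_domain_def elim: eventually_mono)
    then show "\<forall>\<^sub>F s in at_left t. f (x, t) \<le> f (x, s)"
      using min by (auto simp: xt elim: eventually_mono)
  qed
  ultimately show ?thesis
    using mult_nonneg_nonneg[OF \<open>a p \<ge> 0\<close>] by (fastforce simp: parabolic_op_def)
qed

lemma parabolic_minimum_principle:
  assumes "bounded U" "open U" "T > 0" and f: "f \<in> C21 U T"
    and a_nonneg: "\<And>q. q \<in> parabolic_domain U T \<Longrightarrow> a q \<ge> 0"
    and op_pos: "\<And>q. q \<in> parabolic_domain U T \<Longrightarrow> parabolic_op T a f q > 0"
    and z: "z \<in> parabolic_domain U T"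
  shows "\<exists>p. is_arg_min f (\<lambda>q. q \<in> parabolic_boundary U T) p \<and> f p \<le> f z"
proof -
  let ?K = "closure (parabolic_domain U T)"
  have K: "?K = parabolic_domain U T \<union> parabolic_boundary U T"
    using \<open>open U\<close> \<open>T > 0\<close> by (rule closure_parabolic_domain_eq_Un)
  have cont: "continuous_on ?K f" using f by (simp add: C21_def)
  have "?K \<noteq> {}" using z K by blast
  then obtain p where p: "p \<in> ?K" and min: "\<And>q. q \<in> ?K \<Longrightarrow> f p \<le> f q"
    using continuous_attains_inf[OF compact_closure_parabolic_domain[OF \<open>bounded U\<close>] _ cont]
    by blast
  have "p \<notin> parabolic_domain U T"
  proof
    assume p_inside: "p \<in> parabolic_domain U T"
    then have "parabolic_op T a f p \<le> 0"
      using K min a_nonneg by (intro parabolic_op_nonpos_at_min[OF \<open>open U\<close> f]) auto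
    with op_pos[OF p_inside] show False by simp
  qed
  then have "is_arg_min f (\<lambda>q. q \<in> parabolic_boundary U T) p"
    using p min K by (auto simp: is_arg_min_linorder)
  then show ?thesis using min z K by blast
qed

theorem lemma2:
  fixes U :: "(real ^ 'd) set" and T a0 :: real and P :: "real poly"
    and u v :: "(real ^ 'd) \<times> real \<Rightarrow> real"
  assumes "bounded U" and "open U" and "T > 0"
    and "u \<in> C21 U T" and "v \<in> C21 U T"
    and "a0 > 0" and "\<forall>z\<in>parabolic_domain U T. poly P (u z) \<ge> a0"
    and "\<forall>z\<in>parabolic_domain U T. dt T v z - poly P (u z) * laplacian_x v z > 0"
  shows "\<forall>z\<in>parabolic_domain U T.
           \<exists>p. is_arg_min v (\<lambda>q. q \<in> parabolic_boundary U T) p \<and> v z \<ge> v p"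
proof
  fix z assume z: "z \<in> parabolic_domain U T"
  show "\<exists>p. is_arg_min v (\<lambda>q. q \<in> parabolic_boundary U T) p \<and> v z \<ge> v p"
  proof (rule parabolic_minimum_principle[OF assms(1-3,5) _ _ z])
    fix q assume q: "q \<in> parabolic_domain U T"
    show "poly P (u q) \<ge> 0"
      using assms(6,7) q by fastforce
    show "parabolic_op T (\<lambda>q. poly P (u q)) v q > 0"
      using assms(8) q by (simp add: parabolic_op_def)
  qed
qed

end
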